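(* Let $H:\mathbb{R}^{2m}\to\mathbb{R}$ be a sufficiently smooth function (e.g. $C^\infty$), let $y_0\in\mathbb{R}^{2m}$, let $r\ge 1$ be an integer, and let $\{\omega_j\}_{j\ge 0}$ be a system of linearly independent, smooth, real-valued functions on $[0,1]$, mutually orthogonal in $L_2([0,1])$, whose primitives $\int_0^t\omega_j(\tau)\,\mathrm{d}\tau$ are finite linear combinations of functions of the system. Put $\eta_i=\left(\int_0^1\omega_i^2(t)\,\mathrm{d}t\right)^{-1}$ and $J=\begin{pmatrix}0&I_m\\-I_m&0\end{pmatrix}$. Suppose that vectors $\gamma_0,\dots,\gamma_{r-1}\in\mathbb{R}^{2m}$ and the curve $\omega:[0,1]\to\mathbb{R}^{2m}$ given by $$\omega(t)=y_0+\sum_{i=0}^{r-1}\gamma_i\int_0^t\omega_i(\tau)\,\mathrm{d}\tau$$ satisfy $$\gamma_i=\eta_i\int_0^1\omega_i(t)\,J\nabla H(\omega(t))\,\mathrm{d}t,\qquad i=0,\dots,r-1.$$ Set $y_1=\omega(1)$. Then $H(y_1)=H(y_0)$.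
   Context: $I_m$ is the $m\times m$ identity matrix, and $\nabla H$ is the gradient of $H$ (a column vector). The equations for the $\gamma_i$ are implicit, because $\omega$ depends on $\gamma_0,\dots,\gamma_{r-1}$; the result concerns any solution of this system. *)

theory Defs
  imports "HOL-Analysis.Analysis"
begin

definition gradient :: "('a::euclidean_space \<Rightarrow> real) \<Rightarrow> 'a \<Rightarrow> 'a" where
  "gradient f x = (THE D. GDERIV f x :> D)"

lemma gradient_eqI:
  assumes "GDERIV f x :> D"
  shows "gradient f x = D"
  unfolding gradient_def
proof (rule the_equality)
  show "GDERIV f x :> D" by fact
next
  fix E assume "GDERIV f x :> E"
  with assms have "(\<lambda>h. h \<bullet> E) = (\<lambda>h. h \<bullet> D)"
    unfolding gderiv_def by (rule has_derivative_unique[rotated])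
  then have "\<forall>h. h \<bullet> E = h \<bullet> D" by metis
  then show "E = D" by (simp only: vector_eq_ldot)
qed

lemma GDERIV_gradient:
  assumes "f differentiable (at x)"
  shows "GDERIV f x :> gradient f x"
proof -
  obtain f' where f': "(f has_derivative f') (at x)"
    using assms by (auto simp: differentiable_def)
  interpret linear f' using f' by (rule has_derivative_linear)
  have "f' h = h \<bullet> (\<Sum>b\<in>Basis. f' b *\<^sub>R b)" for h
  proof -
    have "f' h = f' (\<Sum>b\<in>Basis. (h \<bullet> b) *\<^sub>R b)"
      by (simp only: euclidean_representation)
    also have "\<dots> = (\<Sum>b\<in>Basis. (h \<bullet> b) * f' b)"
      by (simp only: sum scale real_scaleR_def)
    also have "\<dots> = h \<bullet> (\<Sum>b\<in>Basis. f' b *\<^sub>R b)"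
      by (simp only: inner_sum_right inner_scaleR_right mult.commute)
    finally show ?thesis .
  qed
  then have "f' = (\<lambda>h. h \<bullet> (\<Sum>b\<in>Basis. f' b *\<^sub>R b))" by (rule ext)
  from subst[where P = "\<lambda>g. (f has_derivative g) (at x)", OF this f']
  have D: "GDERIV f x :> (\<Sum>b\<in>Basis. f' b *\<^sub>R b)"
    unfolding gderiv_def .
  show ?thesis unfolding gradient_eqI[OF D] by (rule D)
qed

definition C1 :: "('a::euclidean_space \<Rightarrow> real) \<Rightarrow> bool" where
  "C1 f \<longleftrightarrow> (\<forall>x. f differentiable (at x)) \<and> continuous_on UNIV (gradient f)"

(* C-infinity on S; D k is the k-th derivative, one-sided at the endpoints of a closed interval. *)
definition smooth_on :: "real set \<Rightarrow> (real \<Rightarrow> real) \<Rightarrow> bool" where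
  "smooth_on S f \<longleftrightarrow>
     (\<exists>D :: nat \<Rightarrow> real \<Rightarrow> real.
        (\<forall>t\<in>S. D 0 t = f t) \<and>
        (\<forall>k. \<forall>t\<in>S. (D k has_real_derivative D (Suc k) t) (at t within S)))"

(* Linear independence of the restrictions to S, so that values off S play no role. *)
definition lin_indep_on :: "real set \<Rightarrow> (nat \<Rightarrow> real \<Rightarrow> real) \<Rightarrow> bool" where
  "lin_indep_on S w \<longleftrightarrow>
     (\<forall>K c. finite K \<longrightarrow> (\<forall>t\<in>S. (\<Sum>k\<in>K. c k * w k t) = 0) \<longrightarrow> (\<forall>k\<in>K. c k = 0))"

definition primitives_in_span :: "(nat \<Rightarrow> real \<Rightarrow> real) \<Rightarrow> bool" where
  "primitives_in_span w \<longleftrightarrow>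
     (\<forall>j. \<exists>K c. finite K \<and>
        (\<forall>t\<in>{0..1}. integral {0..t} (w j) = (\<Sum>k\<in>K. c k * w k t)))"

definition L2_orthogonal :: "(nat \<Rightarrow> real \<Rightarrow> real) \<Rightarrow> bool" where
  "L2_orthogonal w \<longleftrightarrow> (\<forall>i j. i \<noteq> j \<longrightarrow> integral {0..1} (\<lambda>t. w i t * w j t) = 0)"

definition eta :: "(nat \<Rightarrow> real \<Rightarrow> real) \<Rightarrow> nat \<Rightarrow> real" where
  "eta w i = inverse (integral {0..1} (\<lambda>t. (w i t)\<^sup>2))"

(* The 2m coordinates are indexed by the sum type 'm + 'm with m = CARD('m):
   Inl for the first m, Inr for the last m. *)
definition J :: "real ^ ('m::finite + 'm) ^ ('m + 'm)" where
  "J = (\<chi> i j. case (i, j) of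
          (Inl a, Inl b) \<Rightarrow> 0
        | (Inl a, Inr b) \<Rightarrow> (mat 1 :: real ^ 'm ^ 'm) $ a $ b
        | (Inr a, Inl b) \<Rightarrow> - (mat 1 :: real ^ 'm ^ 'm) $ a $ b
        | (Inr a, Inr b) \<Rightarrow> 0)"

end

theory Submission
  imports Defs
begin

text \<open>
  The increment of \<open>H\<close> along the curve is the line integral of its gradient,
  \<open>H (\<omega> 1) - H (\<omega> 0) = \<integral> \<nabla>H(\<omega> t) \<bullet> \<omega>' t dt\<close>, and the velocity is
  \<open>\<omega>' t = \<Sum>i<r. w i t *\<^sub>R \<gamma> i\<close>.  Since the \<open>\<gamma> i\<close> are constant vectors, exchanging
  sum and integral turns the increment into \<open>\<Sum>i<r. g i \<bullet> \<gamma> i\<close> with the generalised Fourier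
  coefficients \<open>g i = \<integral> w i t *\<^sub>R \<nabla>H(\<omega> t) dt\<close> of the gradient (\<open>gradient_line_integral\<close>,
  \<open>energy_increment\<close>).  The equations for \<open>\<gamma> i\<close> say exactly that \<open>\<gamma> i\<close> is a multiple
  of \<open>J *v g i\<close>, because a constant matrix can be pulled out of the integral.  As \<open>J\<close> is
  skew-symmetric, each \<open>g i \<bullet> (J *v g i)\<close> vanishes (\<open>inner_J_self\<close>), hence so does
  every summand: the energy is conserved coefficient by coefficient.
\<close>

text \<open>
  In block form \<open>v = (q, p)\<close> gives \<open>J *v v = (p, - q)\<close>, and \<open>q \<bullet> p - p \<bullet> q = 0\<close>.
\<close>

lemma inner_J_self:
  fixes v :: "real ^ ('m::finite + 'm)"
  shows "v \<bullet> (J *v v) = 0"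
proof -
  have sum_UNIV_Plus: "(\<Sum>i\<in>UNIV. f i) = (\<Sum>a\<in>UNIV. f (Inl a)) + (\<Sum>b\<in>UNIV. f (Inr b))"
    for f :: "'m + 'm \<Rightarrow> real"
    unfolding UNIV_Plus_UNIV[symmetric] by (subst sum.Plus) (auto simp: o_def)
  have upper: "(J *v v) $ Inl a = v $ Inr a" for a
    unfolding matrix_vector_mult_def
    by (simp add: J_def mat_def sum_UNIV_Plus if_distrib[of "\<lambda>x. x * _"] cong: if_cong)
  have lower: "(J *v v) $ Inr a = - v $ Inl a" for a
    unfolding matrix_vector_mult_def
    by (simp add: J_def mat_def sum_UNIV_Plus sum_negf if_distrib[of "\<lambda>x. x * _"] cong: if_cong)
  show ?thesis
    by (simp add: inner_vec_def sum_UNIV_Plus upper lower sum_negf mult.commute)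
qed

lemma smooth_on_imp_continuous_on:
  assumes "smooth_on S f"
  shows "continuous_on S f"
proof -
  from assms obtain D where D: "\<And>t. t \<in> S \<Longrightarrow> D (0::nat) t = f t"
    and "\<And>k t. t \<in> S \<Longrightarrow> (D k has_real_derivative D (Suc k) t) (at t within S)"
    unfolding smooth_on_def by blast
  then have "continuous_on S (D 0)"
    by (blast intro: DERIV_continuous_on)
  then show ?thesis
    using D by (simp cong: continuous_on_cong)
qed

text \<open>
  By the chain rule the integrand is the derivative of \<open>f\<close> along the curve, and the
  Henstock--Kurzweil integral recovers a function from its pointwise derivative.
\<close>

lemma gradient_line_integral:
  fixes f :: "'a::euclidean_space \<Rightarrow> real" and \<gamma> :: "real \<Rightarrow> 'a"
  assumes "a \<le> b" and f: "\<And>x. f differentiable (at x)"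
    and \<gamma>: "\<And>t. t \<in> {a..b} \<Longrightarrow> (\<gamma> has_vector_derivative \<gamma>' t) (at t within {a..b})"
  shows "((\<lambda>t. gradient f (\<gamma> t) \<bullet> \<gamma>' t) has_integral f (\<gamma> b) - f (\<gamma> a)) {a..b}"
proof (rule fundamental_theorem_of_calculus[OF \<open>a \<le> b\<close>])
  fix t assume "t \<in> {a..b}"
  have "(f has_derivative (\<lambda>h. h \<bullet> gradient f (\<gamma> t))) (at (\<gamma> t))"
    using GDERIV_gradient[OF f] by (simp add: gderiv_def)
  from has_derivative_compose[OF \<gamma>[OF \<open>t \<in> {a..b}\<close>, unfolded has_vector_derivative_def] this]
  show "((\<lambda>t. f (\<gamma> t)) has_vector_derivative gradient f (\<gamma> t) \<bullet> \<gamma>' t) (at t within {a..b})"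
    by (simp add: has_vector_derivative_def inner_commute)
qed

text \<open>
  The velocity of the curve is a linear combination of scalar functions with constant vectors, so
  the line integral splits into finitely many pairings of a constant vector with a moment of the
  gradient.  The continuity in the first conclusion is what makes these moments exist.
\<close>

lemma energy_increment:
  fixes H :: "'a::euclidean_space \<Rightarrow> real" and \<omega> :: "real \<Rightarrow> 'a"
  assumes H: "C1 H" and "finite I"
    and w: "\<And>i. i \<in> I \<Longrightarrow> continuous_on {0..1} (w i)"
    and \<omega>: "\<And>t. t \<in> {0..1} \<Longrightarrow> \<omega> t = y0 + (\<Sum>i\<in>I. integral {0..t} (w i) *\<^sub>R \<gamma> i)"
  shows "continuous_on {0..1} (\<lambda>t. gradient H (\<omega> t))"
    and "H (\<omega> 1) - H (\<omega> 0) =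
           (\<Sum>i\<in>I. integral {0..1} (\<lambda>t. w i t *\<^sub>R gradient H (\<omega> t)) \<bullet> \<gamma> i)"
proof -
  let ?G = "\<lambda>t. gradient H (\<omega> t)"
  have \<omega>': "(\<omega> has_vector_derivative (\<Sum>i\<in>I. w i t *\<^sub>R \<gamma> i)) (at t within {0..1})"
    if t: "t \<in> {0..1}" for t
  proof (rule has_vector_derivative_transform[OF t \<omega>])
    have "((\<lambda>u. integral {0..u} (w i)) has_real_derivative w i t) (at t within {0..1})"
      if "i \<in> I" for i
      using integral_has_vector_derivative[OF w[OF that] t]
      by (simp add: has_real_derivative_iff_has_vector_derivative)
    then show "((\<lambda>u. y0 + (\<Sum>i\<in>I. integral {0..u} (w i) *\<^sub>R \<gamma> i)) has_vector_derivative
        (\<Sum>i\<in>I. w i t *\<^sub>R \<gamma> i)) (at t within {0..1})"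
      by (auto intro!: derivative_eq_intros)
  qed
  have "continuous_on {0..1} \<omega>"
    using \<omega>' by (rule continuous_on_vector_derivative)
  then show G: "continuous_on {0..1} ?G"
    using H by (auto simp: C1_def intro: continuous_on_compose2[of UNIV "gradient H"])
  have "((\<lambda>t. ?G t \<bullet> (\<Sum>i\<in>I. w i t *\<^sub>R \<gamma> i)) has_integral H (\<omega> 1) - H (\<omega> 0)) {0..1}"
    using H by (intro gradient_line_integral \<omega>') (auto simp: C1_def)
  moreover have "((\<lambda>t. \<Sum>i\<in>I. (w i t *\<^sub>R ?G t) \<bullet> \<gamma> i) has_integral
      (\<Sum>i\<in>I. integral {0..1} (\<lambda>t. w i t *\<^sub>R ?G t) \<bullet> \<gamma> i)) {0..1}"
  proof (intro has_integral_sum \<open>finite I\<close>)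
    fix i assume "i \<in> I"
    then have "(\<lambda>t. w i t *\<^sub>R ?G t) integrable_on {0..1}"
      by (intro integrable_continuous_interval continuous_intros w G)
    from has_integral_linear[OF integrable_integral[OF this] bounded_linear_inner_left]
    show "((\<lambda>t. (w i t *\<^sub>R ?G t) \<bullet> \<gamma> i) has_integral
        integral {0..1} (\<lambda>t. w i t *\<^sub>R ?G t) \<bullet> \<gamma> i) {0..1}"
      by (simp add: o_def)
  qed
  ultimately show "H (\<omega> 1) - H (\<omega> 0) =
      (\<Sum>i\<in>I. integral {0..1} (\<lambda>t. w i t *\<^sub>R ?G t) \<bullet> \<gamma> i)"
    by (auto simp: inner_sum_right intro: has_integral_unique)
qed

theorem theorem1:
  fixes H :: "real ^ ('m::finite + 'm) \<Rightarrow> real"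
    and y0 y1 :: "real ^ ('m + 'm)"
    and r :: nat
    and w :: "nat \<Rightarrow> real \<Rightarrow> real"
    and \<gamma> :: "nat \<Rightarrow> real ^ ('m + 'm)"
    and \<omega> :: "real \<Rightarrow> real ^ ('m + 'm)"
  assumes "C1 H"
    and "r \<ge> 1"
    and "\<And>j. smooth_on {0..1} (w j)"
    and "lin_indep_on {0..1} w"
    and "L2_orthogonal w"
    and "primitives_in_span w"
    and "\<And>t. t \<in> {0..1} \<Longrightarrow> \<omega> t = y0 + (\<Sum>i<r. integral {0..t} (w i) *\<^sub>R \<gamma> i)"
    and "\<And>i. i < r \<Longrightarrow>
           \<gamma> i = eta w i *\<^sub>R integral {0..1} (\<lambda>t. w i t *\<^sub>R (J *v gradient H (\<omega> t)))"
    and "y1 = \<omega> 1"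
  shows "H y1 = H y0"
proof -
  define g where "g i = integral {0..1} (\<lambda>t. w i t *\<^sub>R gradient H (\<omega> t))" for i
  have w: "continuous_on {0..1} (w i)" for i
    using assms(3) by (rule smooth_on_imp_continuous_on)
  note increment = energy_increment[OF \<open>C1 H\<close> finite_lessThan w assms(7)]
  have "\<gamma> i = eta w i *\<^sub>R (J *v g i)" if "i < r" for i
  proof -
    have "(\<lambda>t. w i t *\<^sub>R gradient H (\<omega> t)) integrable_on {0..1}"
      by (intro integrable_continuous_interval continuous_intros w increment(1))
    from integral_linear[OF this matrix_vector_mul_bounded_linear[of J]]
    have "integral {0..1} (\<lambda>t. w i t *\<^sub>R (J *v gradient H (\<omega> t))) = J *v g i"
      by (simp add: g_def o_def matrix_vector_mult_scaleR)
    with assms(8)[OF that] show ?thesis by simp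
  qed
  then have "g i \<bullet> \<gamma> i = 0" if "i < r" for i
    using that by (simp add: inner_J_self)
  with increment(2) have "H (\<omega> 1) = H (\<omega> 0)"
    by (simp add: g_def)
  moreover have "\<omega> 0 = y0"
    using assms(7)[of 0] by simp
  ultimately show ?thesis
    using \<open>y1 = \<omega> 1\<close> by simp
qed

end
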